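(* Let $a_1,a_2,a_3$ be three different points of $\mathbb{CP}^1$. A covering map $f:\mathbb{H}\to\mathbb{CP}^1\setminus\{a_1,a_2,a_3\}$ can be uniquely determined by the equation $$f(\tau)=\frac{a_1(a_2-a_3)-a_3(a_2-a_1)\lambda(\tau)}{(a_2-a_3)-(a_2-a_1)\lambda(\tau)},$$ where $\lambda$ is the modular lambda function. Furthermore, $f(\tau)$ has the expansion $$f(\tau)=a_1+16\frac{(a_1-a_3)(a_2-a_1)}{a_2-a_3}\,q_2+128(a_1-a_3)\left[2\frac{(a_2-a_1)^2}{(a_2-a_3)^2}-\frac{a_2-a_1}{a_2-a_3}\right]q_2^2+O(q_2^3)$$ in $q_2=\exp\{\pi i\tau\}$.
   Context: $\mathbb{H}$ is the upper half plane. The modular lambda function $\lambda$ is the universal covering map $\mathbb{H}\to\mathbb{CP}^1\setminus\{0,1,\infty\}$ with deck transformation group $\Gamma(2)$, with values at the cusps $\infty\mapsto0$, $0\mapsto1$, $1\mapsto\infty$, and with expansion $\lambda(\tau)=16q_2-128q_2^2+704q_2^3-3072q_2^4+O(q_2^5)$ in $q_2=\exp\{\pi i\tau\}$. The formulas are read in the affine coordinate, with the $a_j$ as complex numbers. *)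

theory Defs
  imports "HOL-Analysis.Analysis" "HOL-Library.Landau_Symbols" "HOL-Library.FuncSet"
begin

section \<open>The complex projective line\<close>

text \<open>The set of lines through the origin of \<open>\<complex>\<^sup>2\<close>, with the quotient topology.\<close>

definition collinear_vectors :: "complex \<times> complex \<Rightarrow> complex \<times> complex \<Rightarrow> bool" where
  "collinear_vectors x y \<longleftrightarrow>
     x \<noteq> 0 \<and> y \<noteq> 0 \<and> (\<exists>c. fst x = c * fst y \<and> snd x = c * snd y)"

lemma collinear_vectors_iff:
  "collinear_vectors (z, w) (z', w') \<longleftrightarrow>
     (z, w) \<noteq> 0 \<and> (z', w') \<noteq> 0 \<and> z * w' = z' * w"
proof (intro iffI)
  assume "collinear_vectors (z, w) (z', w')"
  then show "(z, w) \<noteq> 0 \<and> (z', w') \<noteq> 0 \<and> z * w' = z' * w"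
    by (auto simp: collinear_vectors_def)
next
  assume *: "(z, w) \<noteq> 0 \<and> (z', w') \<noteq> 0 \<and> z * w' = z' * w"
  show "collinear_vectors (z, w) (z', w')"
  proof (cases "w' = 0")
    case True
    then have "z' \<noteq> 0" "w = 0" using * by (auto simp: zero_prod_def)
    then have "z = (z / z') * z' \<and> w = (z / z') * w'" using True by simp
    then show ?thesis using * by (auto simp: collinear_vectors_def simp del: times_divide_eq_left)
  next
    case False
    then have "z = (w / w') * z' \<and> w = (w / w') * w'" using * by (simp add: field_simps)
    then show ?thesis using * by (auto simp: collinear_vectors_def simp del: times_divide_eq_left)
  qed
qed

quotient_type cp1 = "complex \<times> complex" / partial: collinear_vectors
proof (rule part_equivpI)
  show "\<exists>x. collinear_vectors x x"
    by (rule exI[of _ "(1, 1)"]) (simp add: collinear_vectors_iff zero_prod_def)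
  show "symp collinear_vectors"
    by (auto simp: symp_def collinear_vectors_iff)
  show "transp collinear_vectors"
  proof (rule transpI)
    fix x y u assume "collinear_vectors x y" "collinear_vectors y u"
    then show "collinear_vectors x u"
      unfolding collinear_vectors_def by (metis mult.assoc)
  qed
qed

instantiation cp1 :: topological_space
begin

definition open_cp1 :: "cp1 set \<Rightarrow> bool" where
  "open_cp1 U \<longleftrightarrow> open {x. x \<noteq> 0 \<and> abs_cp1 x \<in> U}"

instance
proof
  have "{x :: complex \<times> complex. x \<noteq> 0 \<and> abs_cp1 x \<in> UNIV} = - {0}" by auto
  then show "open (UNIV :: cp1 set)" by (simp add: open_cp1_def open_Compl)
next
  fix S T :: "cp1 set" assume "open S" "open T"
  then have "open ({x. x \<noteq> 0 \<and> abs_cp1 x \<in> S} \<inter> {x. x \<noteq> 0 \<and> abs_cp1 x \<in> T})"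
    unfolding open_cp1_def by (rule open_Int)
  moreover have "{x. x \<noteq> 0 \<and> abs_cp1 x \<in> S} \<inter> {x. x \<noteq> 0 \<and> abs_cp1 x \<in> T}
      = {x. x \<noteq> 0 \<and> abs_cp1 x \<in> S \<inter> T}" by auto
  ultimately show "open (S \<inter> T)" by (simp add: open_cp1_def)
next
  fix K :: "cp1 set set" assume "\<forall>S\<in>K. open S"
  then have "open (\<Union>S\<in>K. {x. x \<noteq> 0 \<and> abs_cp1 x \<in> S})"
    by (auto simp: open_cp1_def)
  moreover have "(\<Union>S\<in>K. {x. x \<noteq> 0 \<and> abs_cp1 x \<in> S}) = {x. x \<noteq> 0 \<and> abs_cp1 x \<in> \<Union>K}"
    by auto
  ultimately show "open (\<Union>K)" by (simp add: open_cp1_def)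
qed

end

text \<open>
  \<open>hom_point z w\<close> is the point \<open>[z : w]\<close>, i.e. the quotient \<open>z / w\<close> read in the projective
  line, with value \<open>\<infinity>\<close> for \<open>w = 0\<close>.  It is meaningful only for \<open>(z, w) \<noteq> (0, 0)\<close>.
\<close>

definition hom_point :: "complex \<Rightarrow> complex \<Rightarrow> cp1" where
  "hom_point z w = abs_cp1 (z, w)"

definition cp1_of_complex :: "complex \<Rightarrow> cp1" where
  "cp1_of_complex z = hom_point z 1"

definition cp1_infinity :: cp1 where
  "cp1_infinity = hom_point 1 0"

text \<open>
  The two affine charts \<open>z / w\<close> (away from \<open>\<infinity>\<close>) and \<open>w / z\<close> (away from \<open>0\<close>).  Outside its
  domain each of them takes the junk value \<open>0\<close>.
\<close>

lift_definition affine_coord :: "cp1 \<Rightarrow> complex" is "\<lambda>(z, w). z / w"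
  by (auto simp: collinear_vectors_def zero_prod_def)

lift_definition affine_coord_at_infinity :: "cp1 \<Rightarrow> complex" is "\<lambda>(z, w). w / z"
  by (auto simp: collinear_vectors_def zero_prod_def)

lemma hom_point_eq_iff:
  assumes "(z, w) \<noteq> 0" "(z', w') \<noteq> 0"
  shows "hom_point z w = hom_point z' w' \<longleftrightarrow> z * w' = z' * w"
  unfolding hom_point_def
  using assms Quotient3_rel[OF Quotient3_cp1, of "(z, w)" "(z', w')"]
  by (auto simp: collinear_vectors_iff)

lemma hom_point_eq_of_complex:
  assumes "w \<noteq> 0"
  shows "hom_point z w = cp1_of_complex (z / w)"
  unfolding cp1_of_complex_def using assms
  by (subst hom_point_eq_iff) (auto simp: zero_prod_def)

lemma hom_point_eq_infinity:
  assumes "z \<noteq> 0"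
  shows "hom_point z 0 = cp1_infinity"
  unfolding cp1_infinity_def using assms
  by (subst hom_point_eq_iff) (auto simp: zero_prod_def)

lemma inj_cp1_of_complex: "inj cp1_of_complex"
  by (rule injI) (simp add: cp1_of_complex_def hom_point_eq_iff zero_prod_def)

lemma cp1_of_complex_neq_infinity: "cp1_of_complex z \<noteq> cp1_infinity"
  by (simp add: cp1_of_complex_def cp1_infinity_def hom_point_eq_iff zero_prod_def)

lemma affine_coord_of_complex: "affine_coord (cp1_of_complex z) = z"
  unfolding cp1_of_complex_def hom_point_def
  by (subst affine_coord.abs_eq) (auto simp: collinear_vectors_iff zero_prod_def)


section \<open>Holomorphic covering maps into the projective line\<close>

text \<open>
  Holomorphy on an open set of maps into the Riemann surface \<open>cp1\<close>: continuity, and holomorphy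
  in the charts.  By continuity the junk values of the charts play no role.
\<close>

definition holomorphic_cp1_on :: "(complex \<Rightarrow> cp1) \<Rightarrow> complex set \<Rightarrow> bool" where
  "holomorphic_cp1_on f S \<longleftrightarrow>
     continuous_on S f \<and>
     (\<forall>\<tau>\<in>S. f \<tau> \<noteq> cp1_infinity \<longrightarrow> (\<lambda>t. affine_coord (f t)) analytic_on {\<tau>}) \<and>
     (\<forall>\<tau>\<in>S. f \<tau> \<noteq> cp1_of_complex 0 \<longrightarrow>
        (\<lambda>t. affine_coord_at_infinity (f t)) analytic_on {\<tau>})"

definition upper_half_plane :: "complex set" where
  "upper_half_plane = {\<tau>. Im \<tau> > 0}"

text \<open>Coverings of the upper half plane are universal, since it is simply connected.\<close>

definition holomorphic_covering :: "(complex \<Rightarrow> cp1) \<Rightarrow> cp1 set \<Rightarrow> bool" where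
  "holomorphic_covering f R \<longleftrightarrow>
     holomorphic_cp1_on f upper_half_plane \<and> covering_space upper_half_plane f R"

definition deck_transformations :: "(complex \<Rightarrow> cp1) \<Rightarrow> (complex \<Rightarrow> complex) set" where
  "deck_transformations f =
     {g \<in> extensional upper_half_plane.
        (\<exists>h. homeomorphism upper_half_plane upper_half_plane g h) \<and>
        (\<forall>\<tau>\<in>upper_half_plane. f (g \<tau>) = f \<tau>)}"

text \<open>\<open>\<Gamma>(2)\<close> as a group of transformations of the upper half plane.\<close>

definition Gamma2 :: "(complex \<Rightarrow> complex) set" where
  "Gamma2 =
     {(\<lambda>\<tau>\<in>upper_half_plane. (of_int a * \<tau> + of_int b) / (of_int c * \<tau> + of_int d)) | a b c d :: int.
        a * d - b * c = 1 \<and> odd a \<and> even b \<and> even c \<and> odd d}"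


section \<open>The modular lambda function\<close>

text \<open>
  The filters of neighbourhoods of the cusps in the upper half plane: the half planes
  \<open>Im \<tau> > C\<close> at \<open>i\<infinity>\<close>, and at a real cusp \<open>x\<close> their images under \<open>\<tau> \<mapsto> x - 1 / \<tau>\<close>, i.e. the
  horodiscs tangent to the real line at \<open>x\<close>.
\<close>

definition at_cusp_infinity :: "complex filter" where
  "at_cusp_infinity = filtercomap Im at_top"

definition at_cusp :: "real \<Rightarrow> complex filter" where
  "at_cusp x = filtercomap (\<lambda>\<tau>. Im (- 1 / (\<tau> - of_real x))) at_top"

definition q2 :: "complex \<Rightarrow> complex" where
  "q2 \<tau> = exp (of_real pi * \<i> * \<tau>)"

text \<open>
  \<open>lam\<close>, given in the affine coordinate, is the modular lambda function.  Holomorphy, deck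
  group and cusp values determine it on the upper half plane.  The terms \<open>O(q2^5)\<close> refer to
  \<open>q2 \<rightarrow> 0\<close>, i.e. \<open>Im \<tau> \<rightarrow> \<infinity>\<close>.
\<close>

definition is_modular_lambda :: "(complex \<Rightarrow> complex) \<Rightarrow> bool" where
  "is_modular_lambda lam \<longleftrightarrow>
     holomorphic_covering (\<lambda>\<tau>. cp1_of_complex (lam \<tau>))
       (UNIV - {cp1_of_complex 0, cp1_of_complex 1, cp1_infinity}) \<and>
     deck_transformations (\<lambda>\<tau>. cp1_of_complex (lam \<tau>)) = Gamma2 \<and>
     ((\<lambda>\<tau>. cp1_of_complex (lam \<tau>)) \<longlongrightarrow> cp1_of_complex 0) at_cusp_infinity \<and>
     ((\<lambda>\<tau>. cp1_of_complex (lam \<tau>)) \<longlongrightarrow> cp1_of_complex 1) (at_cusp 0) \<and>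
     ((\<lambda>\<tau>. cp1_of_complex (lam \<tau>)) \<longlongrightarrow> cp1_infinity) (at_cusp 1) \<and>
     (\<lambda>\<tau>. lam \<tau> - (16 * q2 \<tau> - 128 * q2 \<tau> ^ 2 + 704 * q2 \<tau> ^ 3 - 3072 * q2 \<tau> ^ 4))
       \<in> O[at_cusp_infinity](\<lambda>\<tau>. q2 \<tau> ^ 5)"

end

theory Submission
  imports Defs
begin

text \<open>
  The formula for \<open>f\<close> is \<open>M \<circ> \<lambda>\<close> for the Moebius transformation \<open>M\<close> of the projective line with
  \<open>M 0 = a1\<close>, \<open>M 1 = a2\<close> and \<open>M \<infinity> = a3\<close>, and composing a covering with a homeomorphism of the
  base gives a covering.  With \<open>r = (a2 - a1) / (a2 - a3)\<close> one has
  \<open>f - a1 = (a1 - a3) * r\<lambda> / (1 - r\<lambda>)\<close>, so the expansion of \<open>f\<close> is obtained from that of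
  \<open>\<lambda>\<close> by the geometric series.
\<close>

section \<open>Moebius transformations of the projective line\<close>

text \<open>Multiplying by the adjugate matrix recovers the determinant times the original vector,
  so the kernel is trivial.\<close>

lemma linear_image_nonzero:
  fixes a b c d z w :: complex
  assumes "a * d - b * c \<noteq> 0" "(z, w) \<noteq> 0"
  shows "(a * z + b * w, c * z + d * w) \<noteq> 0"
proof
  assume "(a * z + b * w, c * z + d * w) = 0"
  then have h: "a * z + b * w = 0" "c * z + d * w = 0" by (auto simp: zero_prod_def)
  have "(a * d - b * c) * z = d * (a * z + b * w) - b * (c * z + d * w)"
    "(a * d - b * c) * w = a * (c * z + d * w) - c * (a * z + b * w)"
    by (auto simp: algebra_simps)
  then show False using assms h by (auto simp: zero_prod_def)
qed

text \<open>For a singular matrix \<open>moebius\<close> is the identity, to make it total.\<close>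

lift_definition moebius :: "complex \<Rightarrow> complex \<Rightarrow> complex \<Rightarrow> complex \<Rightarrow> cp1 \<Rightarrow> cp1"
  is "\<lambda>a b c d (z, w). if a * d - b * c = 0 then (z, w) else (a * z + b * w, c * z + d * w)"
proof -
  fix a b c d :: complex and x y :: "complex \<times> complex"
  assume xy: "collinear_vectors x y"
  obtain z w z' w' where eq: "x = (z, w)" "y = (z', w')" by fastforce
  show "collinear_vectors
      (case x of (z, w) \<Rightarrow> if a * d - b * c = 0 then (z, w) else (a * z + b * w, c * z + d * w))
      (case y of (z, w) \<Rightarrow> if a * d - b * c = 0 then (z, w) else (a * z + b * w, c * z + d * w))"
  proof (cases "a * d - b * c = 0")
    case False
    obtain k where k: "z = k * z'" "w = k * w'" and nzs: "(z, w) \<noteq> 0" "(z', w') \<noteq> 0"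
      using xy by (auto simp: eq collinear_vectors_def)
    have "a * z + b * w = k * (a * z' + b * w')" "c * z + d * w = k * (c * z' + d * w')"
      by (simp_all add: k algebra_simps)
    then show ?thesis
      using linear_image_nonzero[OF False nzs(1)] linear_image_nonzero[OF False nzs(2)] False
      unfolding collinear_vectors_def eq by (auto simp del: right_minus_eq)
  qed (use xy in \<open>auto simp: eq\<close>)
qed

lemma moebius_abs:
  assumes "a * d - b * c \<noteq> 0" "(z, w) \<noteq> 0"
  shows "moebius a b c d (abs_cp1 (z, w)) = abs_cp1 (a * z + b * w, c * z + d * w)"
  using assms by (subst moebius.abs_eq) (auto simp: collinear_vectors_iff)

lemma moebius_hom_point:
  assumes "a * d - b * c \<noteq> 0" "(z, w) \<noteq> 0"
  shows "moebius a b c d (hom_point z w) = hom_point (a * z + b * w) (c * z + d * w)"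
  using moebius_abs[OF assms] by (simp add: hom_point_def)

text \<open>The quotient is partial: a representative is related to itself, and
  \<open>collinear_vectors\<close> excludes the zero vector.\<close>

lemma cp1_cases:
  obtains z w where "(z, w) \<noteq> 0" "x = hom_point z w"
proof -
  obtain y where y: "collinear_vectors y y" "x = abs_cp1 y"
    using Quotient3_rep_reflp[OF Quotient3_cp1] Quotient3_abs_rep[OF Quotient3_cp1] by metis
  then show ?thesis
    using that by (cases y) (auto simp: hom_point_def collinear_vectors_def)
qed

text \<open>The adjugate serves as the inverse: its product with the matrix is the determinant times
  the identity, and homogeneous coordinates ignore the scalar.\<close>

lemma moebius_inverse:
  assumes "a * d - b * c \<noteq> 0"
  shows "moebius d (- b) (- c) a (moebius a b c d x) = x"
proof -
  obtain z w where zw: "(z, w) \<noteq> 0" "x = hom_point z w" by (rule cp1_cases)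
  have det: "d * a - - b * - c \<noteq> 0" using assms by (simp add: mult.commute)
  note nz = linear_image_nonzero[OF assms zw(1)]
  show ?thesis
    unfolding zw(2) moebius_hom_point[OF assms zw(1)] moebius_hom_point[OF det nz]
    by (subst hom_point_eq_iff[OF linear_image_nonzero[OF det nz] zw(1)]) algebra
qed

text \<open>Openness in \<open>cp1\<close> is tested on nonzero vectors upstairs, where the map is
  linear and hence continuous.\<close>

lemma continuous_on_moebius:
  assumes "a * d - b * c \<noteq> 0"
  shows "continuous_on S (moebius a b c d)"
proof -
  have "open (moebius a b c d -` U)" if "open U" for U
  proof -
    let ?L = "\<lambda>x :: complex \<times> complex. (a * fst x + b * snd x, c * fst x + d * snd x)"
    have "open (?L -` {x. x \<noteq> 0 \<and> abs_cp1 x \<in> U})"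
      using that unfolding open_cp1_def by (rule open_vimage) (intro continuous_intros)
    \<comment> \<open>As the kernel is trivial, \<open>?L\<close> sends nonzero vectors exactly to
      nonzero vectors, so the condition \<open>x \<noteq> 0\<close> pulls back to itself.\<close>
    moreover have "?L -` {x. x \<noteq> 0 \<and> abs_cp1 x \<in> U}
        = {x. x \<noteq> 0 \<and> abs_cp1 x \<in> moebius a b c d -` U}"
    proof (intro set_eqI)
      fix x :: "complex \<times> complex"
      show "x \<in> ?L -` {x. x \<noteq> 0 \<and> abs_cp1 x \<in> U}
          \<longleftrightarrow> x \<in> {x. x \<noteq> 0 \<and> abs_cp1 x \<in> moebius a b c d -` U}"
        using linear_image_nonzero[OF assms, of "fst x" "snd x"]
          moebius_abs[OF assms, of "fst x" "snd x"]
        by (cases "x = 0") (auto simp: zero_prod_def)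
    qed
    ultimately show ?thesis by (simp add: open_cp1_def)
  qed
  then have "continuous_on UNIV (moebius a b c d)"
    by (simp add: continuous_on_open_vimage)
  then show ?thesis by (rule continuous_on_subset) simp
qed

lemma homeomorphism_moebius:
  assumes "a * d - b * c \<noteq> 0"
  shows "homeomorphism S (moebius a b c d ` S) (moebius a b c d) (moebius d (- b) (- c) a)"
proof -
  have det: "d * a - - b * - c \<noteq> 0" using assms by (simp add: mult.commute)
  show ?thesis
    using continuous_on_moebius[OF assms] continuous_on_moebius[OF det] moebius_inverse[OF assms]
    by (auto simp: homeomorphism_def image_image)
qed

section \<open>Coverings followed by a homeomorphism of the base\<close>

lemma covering_space_compose_homeomorphism:
  assumes "covering_space C p S" "homeomorphism S T h k"
  shows "covering_space C (h \<circ> p) T"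
  unfolding covering_space_def
proof (intro conjI ballI)
  show "continuous_on C (h \<circ> p)"
    using assms covering_space_imp_continuous covering_space_imp_surjective
    by (metis continuous_on_compose homeomorphism_cont1)
  show im: "(h \<circ> p) ` C = T"
    using assms covering_space_imp_surjective homeomorphism_image1 by (metis image_comp)
  \<comment> \<open>An evenly covered neighbourhood \<open>U\<close> of \<open>k y\<close> is
    transported by \<open>h\<close> to one of \<open>y\<close>; the sheets \<open>v\<close> stay the
    same.\<close>
  fix y assume "y \<in> T"
  then have "k y \<in> S" using assms(2) by (auto simp: homeomorphism_def)
  then obtain U v where U: "k y \<in> U" "openin (top_of_set S) U"
    and v: "\<Union>v = C \<inter> p -` U" "\<forall>u\<in>v. openin (top_of_set C) u" "pairwise disjnt v"
    and hom: "\<forall>u\<in>v. \<exists>q. homeomorphism u U p q"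
    using assms(1) unfolding covering_space_def by metis
  have US: "U \<subseteq> S" using U(2) by (rule openin_imp_subset)
  have hU: "homeomorphism U (h ` U) h k"
    using assms(2) US by (rule homeomorphism_of_subsets) (use assms(2) US in \<open>auto simp: homeomorphism_def\<close>)
  have pS: "p x \<in> S" if "x \<in> C" for x
    using that assms(1) covering_space_imp_surjective by blast
  have inj: "inj_on h S" using assms(2) by (metis homeomorphism_def inj_on_inverseI)
  \<comment> \<open>Injectivity of \<open>h\<close> on \<open>S\<close> is what keeps the preimage
    from growing; it applies because \<open>p\<close> maps \<open>C\<close> into
    \<open>S\<close>.\<close>
  have "\<Union>v = C \<inter> (h \<circ> p) -` (h ` U)"
    unfolding v(1) vimage_def using inj_on_image_mem_iff[OF inj pS US]
    by (intro Collect_cong set_eqI) (simp only: Int_iff mem_Collect_eq comp_apply cong: conj_cong)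
  moreover have "y \<in> h ` U"
    using U(1) \<open>y \<in> T\<close> assms(2) by (metis homeomorphism_apply2 imageI)
  moreover have "openin (top_of_set T) (h ` U)"
    using homeomorphism_imp_open_map[OF assms(2) U(2)] .
  moreover have "\<forall>u\<in>v. \<exists>q. homeomorphism u (h ` U) (h \<circ> p) q"
    using hom hU homeomorphism_compose by blast
  ultimately show "\<exists>t. y \<in> t \<and> openin (top_of_set T) t \<and>
      (\<exists>v. \<Union>v = C \<inter> (h \<circ> p) -` t \<and> (\<forall>u\<in>v. openin (top_of_set C) u) \<and> pairwise disjnt v \<and>
           (\<forall>u\<in>v. \<exists>q. homeomorphism u t (h \<circ> p) q))"
    using v by blast
qed

section \<open>Charts and holomorphy of the composite\<close>

lemma affine_coord_hom_point:
  "(z, w) \<noteq> 0 \<Longrightarrow> affine_coord (hom_point z w) = z / w"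
  unfolding hom_point_def by (subst affine_coord.abs_eq) (auto simp: collinear_vectors_iff)

lemma affine_coord_at_infinity_hom_point:
  "(z, w) \<noteq> 0 \<Longrightarrow> affine_coord_at_infinity (hom_point z w) = w / z"
  unfolding hom_point_def
  by (subst affine_coord_at_infinity.abs_eq) (auto simp: collinear_vectors_iff)

text \<open>In either chart the composite is a quotient of two affine expressions in
  \<open>l\<close>, so holomorphy reduces to a nonvanishing denominator.\<close>

lemma holomorphic_covering_moebius:
  assumes cov: "holomorphic_covering (\<lambda>\<tau>. cp1_of_complex (l \<tau>)) R"
    and det: "a * d - b * c \<noteq> 0"
  shows "holomorphic_covering (\<lambda>\<tau>. hom_point (a * l \<tau> + b) (c * l \<tau> + d)) (moebius a b c d ` R)"
proof -
  let ?f = "\<lambda>\<tau>. hom_point (a * l \<tau> + b) (c * l \<tau> + d)"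
  have nz: "(a * l \<tau> + b, c * l \<tau> + d) \<noteq> 0" for \<tau>
    using linear_image_nonzero[OF det, of "l \<tau>" 1] by (simp add: zero_prod_def)
  have f: "moebius a b c d \<circ> (\<lambda>\<tau>. cp1_of_complex (l \<tau>)) = ?f"
    using moebius_hom_point[OF det, of _ 1]
    by (auto simp: fun_eq_iff cp1_of_complex_def zero_prod_def)
  have covf: "covering_space upper_half_plane ?f (moebius a b c d ` R)"
    using covering_space_compose_homeomorphism[OF _ homeomorphism_moebius[OF det]] cov
    unfolding holomorphic_covering_def f[symmetric] by blast
  \<comment> \<open>The values \<open>cp1_of_complex (l \<tau>)\<close> are never infinite, so the
    affine chart condition holds everywhere and yields \<open>l\<close> itself.\<close>
  have an: "l analytic_on {\<tau>}" if "\<tau> \<in> upper_half_plane" for \<tau>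
    using cov that cp1_of_complex_neq_infinity
    by (auto simp: holomorphic_covering_def holomorphic_cp1_on_def affine_coord_of_complex)
  have "(\<lambda>t. affine_coord (?f t)) analytic_on {\<tau>}"
    if "\<tau> \<in> upper_half_plane" "?f \<tau> \<noteq> cp1_infinity" for \<tau>
  proof -
    \<comment> \<open>By \<open>nz\<close>, a zero denominator would come with a nonzero numerator,
      and the point would be infinity. In the other chart the numerator plays this part, with the
      point 0.\<close>
    have "c * l \<tau> + d \<noteq> 0" using that(2) nz[of \<tau>] hom_point_eq_infinity by (auto simp: zero_prod_def)
    then show ?thesis
      unfolding affine_coord_hom_point[OF nz]
      by (intro analytic_intros an that) auto
  qed
  moreover have "(\<lambda>t. affine_coord_at_infinity (?f t)) analytic_on {\<tau>}"
    if "\<tau> \<in> upper_half_plane" "?f \<tau> \<noteq> cp1_of_complex 0" for \<tau>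
  proof -
    have "a * l \<tau> + b \<noteq> 0"
      using that(2) nz[of \<tau>] hom_point_eq_of_complex[of "c * l \<tau> + d" 0] by (auto simp: zero_prod_def)
    then show ?thesis
      unfolding affine_coord_at_infinity_hom_point[OF nz]
      by (intro analytic_intros an that) auto
  qed
  ultimately show ?thesis
    using covf covering_space_imp_continuous[OF covf]
    unfolding holomorphic_covering_def holomorphic_cp1_on_def by blast
qed

section \<open>Expansion at the cusp\<close>

text \<open>The norm of \<open>q2\<close> depends on \<open>Im\<close> alone, so the claim is a real
  limit pulled back along \<open>Im\<close>.\<close>

lemma tendsto_q2: "(q2 \<longlongrightarrow> 0) at_cusp_infinity"
proof (rule tendsto_norm_zero_cancel)
  have "norm (q2 \<tau>) = exp (- (pi * Im \<tau>))" for \<tau> by (simp add: q2_def)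
  moreover have "((\<lambda>y. exp (- (pi * y))) \<longlongrightarrow> 0) at_top"
    by (intro filterlim_compose[OF exp_at_bot] filterlim_compose[OF filterlim_uminus_at_bot_at_top]
        filterlim_tendsto_pos_mult_at_top[OF tendsto_const]) (auto simp: filterlim_ident)
  ultimately show "((\<lambda>\<tau>. norm (q2 \<tau>)) \<longlongrightarrow> 0) at_cusp_infinity"
    unfolding at_cusp_infinity_def
    using filterlim_compose[OF _ filterlim_filtercomap[of Im at_top]] by simp
qed

lemma bigo_power_mono:
  fixes q :: "'a \<Rightarrow> complex"
  assumes "(q \<longlongrightarrow> 0) F" "m \<le> n"
  shows "(\<lambda>x. q x ^ n) \<in> O[F](\<lambda>x. q x ^ m)"
proof -
  have "eventually (\<lambda>x. norm (q x) < 1) F"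
    using order_tendstoD(2)[OF tendsto_norm_zero[OF assms(1)], of 1] by simp
  then have "eventually (\<lambda>x. norm (q x ^ n) \<le> 1 * norm (q x ^ m)) F"
    by eventually_elim (simp add: norm_power power_decreasing assms(2))
  then show ?thesis by (rule bigoI)
qed

text \<open>With \<open>y = r * l\<close>, the exact identity
  \<open>y / (1 - y) = y + y^2 + y^3 / (1 - y)\<close> is compared term by term with the claim: the
  linear term contributes \<open>r * v\<close> and the square \<open>r^2 * u^2\<close> to the second
  coefficient.\<close>

lemma moebius_expansion:
  fixes l q :: "'a \<Rightarrow> complex" and r u v :: complex
  assumes q: "(q \<longlongrightarrow> 0) F"
    and l: "(\<lambda>x. l x - (u * q x + v * q x ^ 2)) \<in> O[F](\<lambda>x. q x ^ 3)"
  shows "(l \<longlongrightarrow> 0) F"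
    and "(\<lambda>x. r * l x / (1 - r * l x) - (r * u * q x + (r ^ 2 * u ^ 2 + r * v) * q x ^ 2))
           \<in> O[F](\<lambda>x. q x ^ 3)"
proof -
  note mono = bigo_power_mono[OF q]
  have q32: "(\<lambda>x. q x ^ 3) \<in> O[F](\<lambda>x. q x ^ 2)" by (rule mono) simp
  have q21: "(\<lambda>x. q x ^ 2) \<in> O[F](q)" using mono[of 1 2] by simp
  have "(\<lambda>x. (l x - (u * q x + v * q x ^ 2)) + v * q x ^ 2) \<in> O[F](\<lambda>x. q x ^ 2)"
    by (intro sum_in_bigo landau_o.big_trans[OF l q32]) simp
  then have l1: "(\<lambda>x. l x - u * q x) \<in> O[F](\<lambda>x. q x ^ 2)" by (simp add: algebra_simps)
  have "(\<lambda>x. (l x - u * q x) + u * q x) \<in> O[F](q)"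
    by (intro sum_in_bigo landau_o.big_trans[OF l1 q21]) simp
  then have l0: "l \<in> O[F](q)" by simp
  have "q \<in> o[F](\<lambda>_. 1)" using q by (intro smalloI_tendsto) auto
  then have "l \<in> o[F](\<lambda>_. 1)" by (rule landau_o.big_small_trans[OF l0])
  then show lim: "(l \<longlongrightarrow> 0) F" by (auto dest: smalloD_tendsto)
  have lim1: "((\<lambda>x. 1 - r * l x) \<longlongrightarrow> 1) F"
    using tendsto_diff[OF tendsto_const tendsto_mult_left[OF lim], of 1 r] by simp
  \<comment> \<open>The remainder is a bounded factor times \<open>l ^ 3\<close>, and
    \<open>l\<close> is of order \<open>q\<close>.\<close>
  have "((\<lambda>x. r ^ 3 / (1 - r * l x)) \<longlongrightarrow> r ^ 3) F"
    using tendsto_divide[OF tendsto_const lim1, of "r ^ 3"] by simp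
  then have inv: "(\<lambda>x. r ^ 3 / (1 - r * l x)) \<in> O[F](\<lambda>_. 1)"
    by (intro bigoI_tendsto[of _ _ "r ^ 3"]) auto
  have t3: "(\<lambda>x. r ^ 3 / (1 - r * l x) * l x ^ 3) \<in> O[F](\<lambda>x. q x ^ 3)"
    using landau_o.big.mult[OF inv landau_o.big_power[OF l0, of 3]] by simp
  \<comment> \<open>The error \<open>l^2 - u^2 * q^2\<close> of the square factors into a term of
    order \<open>q^2\<close> and one of order \<open>q\<close>.\<close>
  have "(\<lambda>x. l x + u * q x) \<in> O[F](q)" by (intro sum_in_bigo l0) simp
  from landau_o.big.mult[OF l1 this]
  have t2: "(\<lambda>x. r ^ 2 * ((l x - u * q x) * (l x + u * q x))) \<in> O[F](\<lambda>x. q x ^ 3)"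
    by (simp add: power2_eq_square power3_eq_cube)
  have t1: "(\<lambda>x. r * (l x - (u * q x + v * q x ^ 2))) \<in> O[F](\<lambda>x. q x ^ 3)"
    using l by simp
  have sum: "(\<lambda>x. r * (l x - (u * q x + v * q x ^ 2)) + r ^ 2 * ((l x - u * q x) * (l x + u * q x))
      + r ^ 3 / (1 - r * l x) * l x ^ 3) \<in> O[F](\<lambda>x. q x ^ 3)"
    by (intro sum_in_bigo t1 t2 t3)
  \<comment> \<open>The identity needs a nonzero denominator, which is guaranteed only
    eventually.\<close>
  have "eventually (\<lambda>x. 1 - r * l x \<noteq> 0) F"
    using tendsto_imp_eventually_ne[OF lim1, of 0] by simp
  then have "eventually (\<lambda>x. r * l x / (1 - r * l x) - (r * u * q x + (r ^ 2 * u ^ 2 + r * v) * q x ^ 2)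
      = r * (l x - (u * q x + v * q x ^ 2)) + r ^ 2 * ((l x - u * q x) * (l x + u * q x))
      + r ^ 3 / (1 - r * l x) * l x ^ 3) F"
  proof eventually_elim
    case (elim x)
    have "r * l x / (1 - r * l x) = r * l x + r ^ 2 * l x ^ 2 + r ^ 3 / (1 - r * l x) * l x ^ 3"
      using elim by (simp add: divide_simps) algebra
    then show ?case by algebra
  qed
  from landau_o.big.in_cong[OF this] sum
  show "(\<lambda>x. r * l x / (1 - r * l x) - (r * u * q x + (r ^ 2 * u ^ 2 + r * v) * q x ^ 2))
      \<in> O[F](\<lambda>x. q x ^ 3)" by blast
qed

text \<open>Truncates the given expansion of \<open>lam\<close> to the form with
  \<open>u = 16\<close> and \<open>v = -128\<close>; the cubic and quartic terms join the
  error.\<close>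

lemma modular_lambda_expansion:
  assumes "is_modular_lambda lam"
  shows "(\<lambda>\<tau>. lam \<tau> - (16 * q2 \<tau> + (- 128) * q2 \<tau> ^ 2)) \<in> O[at_cusp_infinity](\<lambda>\<tau>. q2 \<tau> ^ 3)"
proof -
  note mono = bigo_power_mono[OF tendsto_q2]
  have "(\<lambda>\<tau>. lam \<tau> - (16 * q2 \<tau> - 128 * q2 \<tau> ^ 2 + 704 * q2 \<tau> ^ 3 - 3072 * q2 \<tau> ^ 4))
       \<in> O[at_cusp_infinity](\<lambda>\<tau>. q2 \<tau> ^ 5)"
    using assms by (simp add: is_modular_lambda_def)
  then have "(\<lambda>\<tau>. lam \<tau> - (16 * q2 \<tau> - 128 * q2 \<tau> ^ 2 + 704 * q2 \<tau> ^ 3 - 3072 * q2 \<tau> ^ 4))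
       \<in> O[at_cusp_infinity](\<lambda>\<tau>. q2 \<tau> ^ 3)"
    using landau_o.big_trans[OF _ mono[of 3 5]] by simp
  moreover have "(\<lambda>\<tau>. 704 * q2 \<tau> ^ 3 - 3072 * q2 \<tau> ^ 4) \<in> O[at_cusp_infinity](\<lambda>\<tau>. q2 \<tau> ^ 3)"
    using mono[of 3 4] by (intro sum_in_bigo) auto
  ultimately show ?thesis by (auto dest: sum_in_bigo simp: algebra_simps)
qed

section \<open>The covering map omitting three given points\<close>

theorem corollary8p8:
  fixes lam :: "complex \<Rightarrow> complex" and a1 a2 a3 :: complex
  assumes "is_modular_lambda lam"
    and "a1 \<noteq> a2" and "a1 \<noteq> a3" and "a2 \<noteq> a3"
  shows "\<exists>f :: complex \<Rightarrow> cp1.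
    holomorphic_covering f (UNIV - {cp1_of_complex a1, cp1_of_complex a2, cp1_of_complex a3}) \<and>
    (\<forall>\<tau>\<in>upper_half_plane. f \<tau> = hom_point (a1 * (a2 - a3) - a3 * (a2 - a1) * lam \<tau>)
                                          ((a2 - a3) - (a2 - a1) * lam \<tau>)) \<and>
    (\<forall>g. holomorphic_covering g (UNIV - {cp1_of_complex a1, cp1_of_complex a2, cp1_of_complex a3}) \<and>
         (\<forall>\<tau>\<in>upper_half_plane. g \<tau> = hom_point (a1 * (a2 - a3) - a3 * (a2 - a1) * lam \<tau>)
                                               ((a2 - a3) - (a2 - a1) * lam \<tau>)) \<longrightarrow>
         (\<forall>\<tau>\<in>upper_half_plane. g \<tau> = f \<tau>)) \<and>
    (\<forall>\<^sub>F \<tau> in at_cusp_infinity. f \<tau> \<noteq> cp1_infinity) \<and>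
    (\<lambda>\<tau>. affine_coord (f \<tau>) -
          (a1 + 16 * ((a1 - a3) * (a2 - a1) / (a2 - a3)) * q2 \<tau>
              + 128 * (a1 - a3) * (2 * ((a2 - a1)^2 / (a2 - a3)^2) - (a2 - a1) / (a2 - a3)) * q2 \<tau> ^ 2))
      \<in> O[at_cusp_infinity](\<lambda>\<tau>. q2 \<tau> ^ 3)"
proof -
  define A B r where "A = a2 - a3" and "B = a2 - a1" and "r = B / A"
  have A: "A \<noteq> 0" and B: "B \<noteq> 0" using assms by (auto simp: A_def B_def)
  \<comment> \<open>The matrix is read off from the formula for \<open>f\<close>; its determinant is
    nonzero exactly because the three points are distinct.\<close>
  define a b c d where "a = - (a3 * B)" and "b = a1 * A" and "c = - B" and "d = A"
  note abcd = a_def b_def c_def d_def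
  have "a * d - b * c = A * B * (a1 - a3)" by (simp add: abcd algebra_simps)
  then have det: "a * d - b * c \<noteq> 0" using A B assms by simp
  define f where "f = (\<lambda>\<tau>. hom_point (a * lam \<tau> + b) (c * lam \<tau> + d))"
  have nz: "(a * lam \<tau> + b, c * lam \<tau> + d) \<noteq> 0" for \<tau>
    using linear_image_nonzero[OF det, of "lam \<tau>" 1] by (simp add: zero_prod_def)

  have M: "moebius a b c d (hom_point z w) = cp1_of_complex y"
    if "(z, w) \<noteq> 0" "a * z + b * w = y * (c * z + d * w)" for z w y
    unfolding moebius_hom_point[OF det that(1)] cp1_of_complex_def
    using linear_image_nonzero[OF det that(1)] that(2)
    by (subst hom_point_eq_iff) (auto simp: zero_prod_def)
  have M0: "moebius a b c d (cp1_of_complex 0) = cp1_of_complex a1"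
    unfolding cp1_of_complex_def[of 0] by (rule M) (auto simp: zero_prod_def abcd)
  have M1: "moebius a b c d (cp1_of_complex 1) = cp1_of_complex a2"
    unfolding cp1_of_complex_def[of 1]
    by (rule M) (auto simp: zero_prod_def abcd A_def B_def algebra_simps)
  have Minf: "moebius a b c d cp1_infinity = cp1_of_complex a3"
    unfolding cp1_infinity_def by (rule M) (auto simp: zero_prod_def abcd)
  have "inj (moebius a b c d)" by (rule inj_on_inverseI, rule moebius_inverse[OF det])
  \<comment> \<open>The inversion lemma applied to the adjugate matrix, whose own adjugate is the
    original one.\<close>
  moreover have "surj (moebius a b c d)"
    using moebius_inverse[of d a "- b" "- c"] det by (auto simp: surj_def mult.commute) metis
  ultimately have im: "moebius a b c d ` (UNIV - {cp1_of_complex 0, cp1_of_complex 1, cp1_infinity})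
      = UNIV - {cp1_of_complex a1, cp1_of_complex a2, cp1_of_complex a3}"
    by (simp add: image_set_diff M0 M1 Minf)
  have cov: "holomorphic_covering f (UNIV - {cp1_of_complex a1, cp1_of_complex a2, cp1_of_complex a3})"
    using holomorphic_covering_moebius[OF _ det] assms(1)
    unfolding f_def im[symmetric] is_modular_lambda_def by blast
  have formula: "f \<tau> = hom_point (a1 * (a2 - a3) - a3 * (a2 - a1) * lam \<tau>)
      ((a2 - a3) - (a2 - a1) * lam \<tau>)" for \<tau>
    by (simp add: f_def abcd A_def B_def algebra_simps)

  note lexp = modular_lambda_expansion[OF assms(1)]
  \<comment> \<open>Since \<open>lam\<close> tends to 0, the denominator tends to
    \<open>d = a2 - a3\<close>, so near the cusp \<open>f\<close> is finite and
    \<open>affine_coord\<close> does not take its default value.\<close>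
  have "((\<lambda>\<tau>. c * lam \<tau> + d) \<longlongrightarrow> d) at_cusp_infinity"
    using tendsto_add[OF tendsto_mult_left[OF moebius_expansion(1)[OF tendsto_q2 lexp]] tendsto_const,
        of c d] by simp
  then have ev: "\<forall>\<^sub>F \<tau> in at_cusp_infinity. c * lam \<tau> + d \<noteq> 0"
    using A by (intro tendsto_imp_eventually_ne) (auto simp: d_def)
  then have fin: "\<forall>\<^sub>F \<tau> in at_cusp_infinity. f \<tau> \<noteq> cp1_infinity"
    by eventually_elim (simp add: f_def hom_point_eq_of_complex cp1_of_complex_neq_infinity)

  let ?E = "\<lambda>\<tau>. affine_coord (f \<tau>) -
          (a1 + 16 * ((a1 - a3) * (a2 - a1) / (a2 - a3)) * q2 \<tau>
              + 128 * (a1 - a3) * (2 * ((a2 - a1)^2 / (a2 - a3)^2) - (a2 - a1) / (a2 - a3)) * q2 \<tau> ^ 2)"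
  \<comment> \<open>For \<open>u = 16\<close> and \<open>v = -128\<close> the second coefficient is
    \<open>256 * r^2 - 128 * r\<close>, that is \<open>128 * (2 * r^2 - r)\<close>.\<close>
  from ev have "\<forall>\<^sub>F \<tau> in at_cusp_infinity. ?E \<tau> = (a1 - a3) * (r * lam \<tau> / (1 - r * lam \<tau>)
      - (r * 16 * q2 \<tau> + (r ^ 2 * 16 ^ 2 + r * (- 128)) * q2 \<tau> ^ 2))"
  proof eventually_elim
    case (elim \<tau>)
    then have D: "A - B * lam \<tau> \<noteq> 0" by (simp add: abcd)
    have "affine_coord (f \<tau>) = (a1 * A - a3 * B * lam \<tau>) / (A - B * lam \<tau>)"
      unfolding f_def affine_coord_hom_point[OF nz] by (simp add: abcd)
    also have "\<dots> = a1 + (a1 - a3) * (B * lam \<tau> / (A - B * lam \<tau>))"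
      using D by (simp add: field_simps)
    also have "B * lam \<tau> / (A - B * lam \<tau>) = r * lam \<tau> / (1 - r * lam \<tau>)"
      using A D by (simp add: r_def divide_simps)
    finally have *: "affine_coord (f \<tau>) = a1 + (a1 - a3) * (r * lam \<tau> / (1 - r * lam \<tau>))" .
    have r: "(a1 - a3) * (a2 - a1) / (a2 - a3) = (a1 - a3) * r"
      "(a2 - a1)^2 / (a2 - a3)^2 = r ^ 2" "(a2 - a1) / (a2 - a3) = r"
      by (simp_all add: r_def A_def B_def power_divide)
    show ?case unfolding * r by (simp add: algebra_simps)
  qed
  moreover have "(\<lambda>\<tau>. (a1 - a3) * (r * lam \<tau> / (1 - r * lam \<tau>)
      - (r * 16 * q2 \<tau> + (r ^ 2 * 16 ^ 2 + r * (- 128)) * q2 \<tau> ^ 2)))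
      \<in> O[at_cusp_infinity](\<lambda>\<tau>. q2 \<tau> ^ 3)"
    by (subst landau_o.big.cmult_in_iff)
      (use assms(3) in simp, rule moebius_expansion(2)[OF tendsto_q2 lexp])
  ultimately have exp: "?E \<in> O[at_cusp_infinity](\<lambda>\<tau>. q2 \<tau> ^ 3)"
    by (subst landau_o.big.in_cong)
  \<comment> \<open>Uniqueness is immediate, as the formula fixes every value on
    \<open>upper_half_plane\<close>.\<close>
  show ?thesis
    by (intro exI[of _ f] conjI allI impI ballI cov formula fin exp) (simp add: formula)
qed

end
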